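(* Let $(E,\mathscr{T},\le)$ be a $T_2$-preordered $k$-preserving space whose topology is a $k_\omega$-space. Then $E$ is convex at every point $x\in E$ such that (i) the topology does not distinguish different points of $[x]$, and (ii) local compactness holds at $x$ (for instance, at every point $x$ at which $E$ is locally compact and antisymmetric). In particular, every $k$-preserving $T_2$-ordered locally compact $\sigma$-compact space is convex (and hence quasi-uniformizable).
   Context: A topological preordered space is a triple $(E,\mathscr{T},\le)$ with $(E,\mathscr{T})$ a topological space (not assumed Hausdorff) and $\le$ a reflexive and transitive relation. Set $i(x)=\{y: x\le y\}$, $d(x)=\{y: y\le x\}$, $[x]=d(x)\cap i(x)$, $i(S)=\bigcup_{x\in S} i(x)$, $d(S)=\bigcup_{x\in S} d(x)$. A set $S$ is increasing if $i(S)=S$, decreasing if $d(S)=S$. The space is $T_2$-preordered if the graph $G(\le)=\{(x,y):x\le y\}$ is closed in $E\times E$, and $T_2$-ordered if moreover $\le$ is antisymmetric. Antisymmetric at $x$ means $[x]=\{x\}$. "The topology does not distinguish the points of $[x]$" means that every open set containing one point of $[x]$ contains all of $[x]$. A $T_2$-preordered space $E$ is $k$-preserving if for every compact $K\subset E$ the convex hull $d(K)\cap i(K)$ is compact. A topological space is a $k_\omega$-space if there is a sequence of compact sets $K_i$ with $\bigcup_i K_i=E$ such that $O\subset E$ is open if and only if $O\cap K_i$ is open in $K_i$ for every $i$. Locally compact at $x$ means that $x$ has a compact neighborhood; locally compact means this at every point. The space is convex at $x$ if for every open neighborhood $O$ of $x$ there are an open decreasing set $U$ and an open increasing set $V$ with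 $x\in U\cap V\subset O$; it is convex if it is convex at every point. A quasi-uniformity on $E$ is a filter $\mathcal{U}$ on $E\times E$ whose elements contain the diagonal and such that for every $V\in\mathcal{U}$ there is $W\in\mathcal{U}$ with $W\circ W\subset V$. $\mathcal{U}^*$ is the coarsest uniformity containing $\mathcal{U}$, given by the sets $V\cap W^{-1}$, $V,W\in\mathcal{U}$; $\mathscr{T}(\mathcal{U}^* )$ is its topology. $(E,\mathscr{T},\le)$ is quasi-uniformizable if there is a quasi-uniformity $\mathcal{U}$ on $E$ with $\mathscr{T}=\mathscr{T}(\mathcal{U}^* )$ and $G(\le)=\bigcap\mathcal{U}$. *)

theory Defs
  imports "HOL-Analysis.Analysis"
begin

section \<open>Topological preordered spaces\<close>

text \<open>
  The preorder is represented by its graph \<open>R\<close>, so that \<open>i(S) = R `` S\<close> and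
  \<open>d(S) = R\<inverse> `` S\<close>. Since \<^const>\<open>preorder_on\<close> includes \<open>R \<subseteq> E \<times> E\<close>,
  these sets do not leave the space.
\<close>

definition T2_preordered :: "'a topology \<Rightarrow> 'a rel \<Rightarrow> bool" where
  "T2_preordered X R \<longleftrightarrow> preorder_on (topspace X) R \<and> closedin (prod_topology X X) R"

definition T2_ordered :: "'a topology \<Rightarrow> 'a rel \<Rightarrow> bool" where
  "T2_ordered X R \<longleftrightarrow> T2_preordered X R \<and> antisym R"

definition inc_hull :: "'a rel \<Rightarrow> 'a set \<Rightarrow> 'a set" where
  "inc_hull R S = R `` S"

definition dec_hull :: "'a rel \<Rightarrow> 'a set \<Rightarrow> 'a set" where
  "dec_hull R S = R\<inverse> `` S"

definition order_class :: "'a rel \<Rightarrow> 'a \<Rightarrow> 'a set" where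
  "order_class R x = dec_hull R {x} \<inter> inc_hull R {x}"

definition increasing_set :: "'a rel \<Rightarrow> 'a set \<Rightarrow> bool" where
  "increasing_set R S \<longleftrightarrow> inc_hull R S = S"

definition decreasing_set :: "'a rel \<Rightarrow> 'a set \<Rightarrow> bool" where
  "decreasing_set R S \<longleftrightarrow> dec_hull R S = S"

definition antisymmetric_at :: "'a rel \<Rightarrow> 'a \<Rightarrow> bool" where
  "antisymmetric_at R x \<longleftrightarrow> order_class R x = {x}"

definition class_indistinguishable_at :: "'a topology \<Rightarrow> 'a rel \<Rightarrow> 'a \<Rightarrow> bool" where
  "class_indistinguishable_at X R x \<longleftrightarrow>
     (\<forall>U. openin X U \<and> U \<inter> order_class R x \<noteq> {} \<longrightarrow> order_class R x \<subseteq> U)"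

definition k_preserving :: "'a topology \<Rightarrow> 'a rel \<Rightarrow> bool" where
  "k_preserving X R \<longleftrightarrow> (\<forall>K. compactin X K \<longrightarrow> compactin X (dec_hull R K \<inter> inc_hull R K))"

definition convex_at :: "'a topology \<Rightarrow> 'a rel \<Rightarrow> 'a \<Rightarrow> bool" where
  "convex_at X R x \<longleftrightarrow>
     (\<forall>W. openin X W \<and> x \<in> W \<longrightarrow>
        (\<exists>U V. openin X U \<and> decreasing_set R U \<and> openin X V \<and> increasing_set R V \<and>
               x \<in> U \<inter> V \<and> U \<inter> V \<subseteq> W))"

definition convex_space :: "'a topology \<Rightarrow> 'a rel \<Rightarrow> bool" where
  "convex_space X R \<longleftrightarrow> (\<forall>x \<in> topspace X. convex_at X R x)"


section \<open>Compactness conditions\<close>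

text \<open>No Hausdorff assumption is part of any of these notions.\<close>

definition k_omega_space :: "'a topology \<Rightarrow> bool" where
  "k_omega_space X \<longleftrightarrow>
     (\<exists>K :: nat \<Rightarrow> 'a set. (\<forall>i. compactin X (K i)) \<and> (\<Union>i. K i) = topspace X \<and>
        (\<forall>U. U \<subseteq> topspace X \<longrightarrow>
             (openin X U \<longleftrightarrow> (\<forall>i. openin (subtopology X (K i)) (U \<inter> K i)))))"

definition sigma_compact_space :: "'a topology \<Rightarrow> bool" where
  "sigma_compact_space X \<longleftrightarrow>
     (\<exists>K :: nat \<Rightarrow> 'a set. (\<forall>i. compactin X (K i)) \<and> (\<Union>i. K i) = topspace X)"

text \<open>The pointwise version of \<^const>\<open>locally_compact_space\<close>.\<close>

definition locally_compact_at :: "'a topology \<Rightarrow> 'a \<Rightarrow> bool" where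
  "locally_compact_at X x \<longleftrightarrow>
     (\<exists>U K. openin X U \<and> compactin X K \<and> x \<in> U \<and> U \<subseteq> K)"

lemma locally_compact_space_iff_at:
  "locally_compact_space X \<longleftrightarrow> (\<forall>x \<in> topspace X. locally_compact_at X x)"
  by (simp add: locally_compact_space_def locally_compact_at_def)


section \<open>Quasi-uniformities\<close>

text \<open>
  Filters on \<open>E \<times> E\<close> are sets of subsets of \<open>E \<times> E\<close>. They are not required to be proper;
  as all members contain the diagonal, this only matters for \<open>E = {}\<close>.
\<close>

definition quasi_uniformity :: "'a set \<Rightarrow> 'a rel set \<Rightarrow> bool" where
  "quasi_uniformity E \<U> \<longleftrightarrow>
     \<U> \<subseteq> Pow (E \<times> E) \<and> \<U> \<noteq> {} \<and>
     (\<forall>V\<in>\<U>. \<forall>W\<in>\<U>. V \<inter> W \<in> \<U>) \<and>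
     (\<forall>V\<in>\<U>. \<forall>W. V \<subseteq> W \<and> W \<subseteq> E \<times> E \<longrightarrow> W \<in> \<U>) \<and>
     (\<forall>V\<in>\<U>. Id_on E \<subseteq> V) \<and>
     (\<forall>V\<in>\<U>. \<exists>W\<in>\<U>. W O W \<subseteq> V)"

definition is_uniformity :: "'a set \<Rightarrow> 'a rel set \<Rightarrow> bool" where
  "is_uniformity E \<D> \<longleftrightarrow> quasi_uniformity E \<D> \<and> (\<forall>V\<in>\<D>. V\<inverse> \<in> \<D>)"

definition star_uniformity :: "'a rel set \<Rightarrow> 'a rel set" where
  "star_uniformity \<U> = {V \<inter> W\<inverse> | V W. V \<in> \<U> \<and> W \<in> \<U>}"

definition uniform_topology :: "'a set \<Rightarrow> 'a rel set \<Rightarrow> 'a topology" where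
  "uniform_topology E \<D> = topology (\<lambda>U. U \<subseteq> E \<and> (\<forall>x\<in>U. \<exists>D\<in>\<D>. D `` {x} \<subseteq> U))"

definition quasi_uniformizable :: "'a topology \<Rightarrow> 'a rel \<Rightarrow> bool" where
  "quasi_uniformizable X R \<longleftrightarrow>
     (\<exists>\<U>. quasi_uniformity (topspace X) \<U> \<and>
          X = uniform_topology (topspace X) (star_uniformity \<U>) \<and> R = \<Inter>\<U>)"

lemma is_uniformity_star_uniformity:
  assumes "quasi_uniformity E \<U>"
  shows "is_uniformity E (star_uniformity \<U>)"
proof -
  have sub: "\<U> \<subseteq> Pow (E \<times> E)" and ne: "\<U> \<noteq> {}"
    and int: "\<And>V W. V \<in> \<U> \<Longrightarrow> W \<in> \<U> \<Longrightarrow> V \<inter> W \<in> \<U>"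
    and up: "\<And>V W. V \<in> \<U> \<Longrightarrow> V \<subseteq> W \<Longrightarrow> W \<subseteq> E \<times> E \<Longrightarrow> W \<in> \<U>"
    and diag: "\<And>V. V \<in> \<U> \<Longrightarrow> Id_on E \<subseteq> V"
    and comp: "\<And>V. V \<in> \<U> \<Longrightarrow> \<exists>W\<in>\<U>. W O W \<subseteq> V"
    using assms by (simp_all add: quasi_uniformity_def)
  let ?D = "star_uniformity \<U>"
  have I: "V \<inter> W\<inverse> \<in> ?D" if "V \<in> \<U>" "W \<in> \<U>" for V W
    using that unfolding star_uniformity_def by blast
  have E: "\<exists>V\<in>\<U>. \<exists>W\<in>\<U>. D = V \<inter> W\<inverse>" if "D \<in> ?D" for D
    using that unfolding star_uniformity_def by blast
  have 1: "?D \<subseteq> Pow (E \<times> E)"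
    using E sub by fastforce
  have 2: "?D \<noteq> {}"
    using ne I by blast
  have 3: "A \<inter> B \<in> ?D" if AB: "A \<in> ?D" "B \<in> ?D" for A B
  proof -
    obtain V W V' W' where *: "V \<in> \<U>" "W \<in> \<U>" "A = V \<inter> W\<inverse>" "V' \<in> \<U>" "W' \<in> \<U>" "B = V' \<inter> W'\<inverse>"
      using E AB by metis
    have "A \<inter> B = (V \<inter> V') \<inter> (W \<inter> W')\<inverse>"
      unfolding * by blast
    then show ?thesis
      using I int * by metis
  qed
  have 4: "B \<in> ?D" if AB: "A \<in> ?D" "A \<subseteq> B" "B \<subseteq> E \<times> E" for A B
  proof -
    obtain V W where *: "V \<in> \<U>" "W \<in> \<U>" "A = V \<inter> W\<inverse>"
      using E AB by metis
    have "V \<subseteq> E \<times> E" "W \<subseteq> E \<times> E"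
      using * sub by auto
    then have "V \<union> B \<subseteq> E \<times> E" "W \<union> B\<inverse> \<subseteq> E \<times> E"
      using AB(3) by blast+
    then have "V \<union> B \<in> \<U>" "W \<union> B\<inverse> \<in> \<U>"
      using up[OF *(1) Un_upper1] up[OF *(2) Un_upper1] by metis+
    moreover have "B = (V \<union> B) \<inter> (W \<union> B\<inverse>)\<inverse>"
      using AB * by blast
    ultimately show ?thesis
      using I by metis
  qed
  have 5: "Id_on E \<subseteq> A" if "A \<in> ?D" for A
    using E[OF that] diag by fastforce
  have 6: "\<exists>B\<in>?D. B O B \<subseteq> A" if A: "A \<in> ?D" for A
  proof -
    obtain V W where *: "V \<in> \<U>" "W \<in> \<U>" "A = V \<inter> W\<inverse>"
      using E A by metis
    obtain V' W' where **: "V' \<in> \<U>" "W' \<in> \<U>" "V' O V' \<subseteq> V" "W' O W' \<subseteq> W"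
      using comp * by metis
    have "(V' \<inter> W'\<inverse>) O (V' \<inter> W'\<inverse>) \<subseteq> A"
      unfolding * using **(3,4) by blast
    then show ?thesis
      using I ** by blast
  qed
  have 7: "A\<inverse> \<in> ?D" if A: "A \<in> ?D" for A
  proof -
    obtain V W where *: "V \<in> \<U>" "W \<in> \<U>" "A = V \<inter> W\<inverse>"
      using E A by metis
    have "A\<inverse> = W \<inter> V\<inverse>"
      unfolding * by blast
    then show ?thesis
      using I * by metis
  qed
  show ?thesis
    unfolding is_uniformity_def quasi_uniformity_def
    by (intro conjI ballI allI impI 1 2 3 5 6 7) (assumption | elim conjE, rule 4)+
qed

lemma openin_uniform_topology:
  assumes "is_uniformity E \<D>"
  shows "openin (uniform_topology E \<D>) U \<longleftrightarrow> U \<subseteq> E \<and> (\<forall>x\<in>U. \<exists>D\<in>\<D>. D `` {x} \<subseteq> U)"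
proof -
  have int: "V \<inter> W \<in> \<D>" if "V \<in> \<D>" "W \<in> \<D>" for V W
    using assms that by (simp add: is_uniformity_def quasi_uniformity_def)
  let ?P = "\<lambda>U. U \<subseteq> E \<and> (\<forall>x\<in>U. \<exists>D\<in>\<D>. D `` {x} \<subseteq> U)"
  have "?P (S \<inter> T)" if S: "?P S" and T: "?P T" for S T
  proof (intro conjI ballI)
    show "S \<inter> T \<subseteq> E" using S by blast
    fix x assume "x \<in> S \<inter> T"
    then obtain V W where "V \<in> \<D>" "V `` {x} \<subseteq> S" "W \<in> \<D>" "W `` {x} \<subseteq> T"
      using S T by blast
    then show "\<exists>D\<in>\<D>. D `` {x} \<subseteq> S \<inter> T"
      by (intro bexI[of _ "V \<inter> W"]) (auto simp: int)
  qed
  moreover have "?P (\<Union>\<K>)" if K: "\<forall>S\<in>\<K>. ?P S" for \<K>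
  proof (intro conjI ballI)
    show "\<Union>\<K> \<subseteq> E" using K by blast
    fix x assume "x \<in> \<Union>\<K>"
    then obtain S where S: "S \<in> \<K>" "x \<in> S" by blast
    then obtain D where "D \<in> \<D>" "D `` {x} \<subseteq> S" using K by blast
    then show "\<exists>D\<in>\<D>. D `` {x} \<subseteq> \<Union>\<K>" using S by blast
  qed
  ultimately have "istopology ?P"
    unfolding istopology_def by blast
  then show ?thesis
    by (simp add: uniform_topology_def)
qed

end

theory Submission
  imports Defs
begin

text \<open>
  Let \<open>W\<close> be an open neighbourhood of a point \<open>x\<close> whose order class lies in \<open>W\<close>. In a compact
  space the closed decreasing set \<open>d(x)\<close> and the closed increasing set \<open>i(x)\<close>, which meet in \<open>[x]\<close>,
  have closed monotone neighbourhoods that still meet inside \<open>W\<close>: closed preorders on compact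
  spaces are normal (\<open>compact_imp_normally_preordered\<close>), by compactness of two disjoint monotone sets
  and closedness of the graph.

  A k-omega-space is treated by induction along an exhaustion by compact sets \<open>K n\<close>. Suppose that
  monotone neighbourhoods \<open>S\<close> and \<open>T\<close> relative to \<open>K n\<close> are given, closed in it and with
  \<open>S \<inter> T \<subseteq> W\<close>. Their hulls \<open>d(S)\<close> and \<open>i(T)\<close> are closed, and they can be enlarged to neighbourhoods
  relative to \<open>K (Suc n)\<close> as soon as \<open>d(S) \<inter> i(T) \<subseteq> W\<close>. This is where k-preservation enters: the
  \<open>K n\<close> can be taken convex, so that \<open>d(S) \<inter> i(T)\<close> does not leave \<open>K n\<close>, where it is \<open>S \<inter> T\<close>. The
  unions of the two sequences are monotone, and open because openness is tested on the \<open>K n\<close>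
  (\<open>monotone_neighbourhoods_by_exhaustion\<close>).

  The same induction with \<open>W = {}\<close> shows that closed preorders on k-omega-spaces are normal; there
  transitivity takes the place of convexity, as a point of \<open>d(S) \<inter> i(T)\<close> would yield a point of \<open>S \<inter> T\<close> by transitivity.
  Normality and convexity together give a quasi-uniformity, generated by the relations
  \<open>{(p, q). q \<in> A \<longrightarrow> p \<in> U}\<close> with \<open>A\<close> closed decreasing, \<open>U\<close> open decreasing and \<open>A \<subseteq> U\<close>.
  Normality interpolates between \<open>A\<close> and \<open>U\<close>, which is the halving axiom, and convexity identifies
  the topology. A locally compact sigma-compact space is a k-omega-space, which reduces the second
  part to the first.
\<close>

section \<open>Hulls in closed preorders\<close>

lemma T2_preorderedD:
  assumes "T2_preordered X R"
  shows "R \<subseteq> topspace X \<times> topspace X"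
    and "\<And>x. x \<in> topspace X \<Longrightarrow> (x, x) \<in> R"
    and "\<And>x y z. (x, y) \<in> R \<Longrightarrow> (y, z) \<in> R \<Longrightarrow> (x, z) \<in> R"
    and "closedin (prod_topology X X) R"
  using assms unfolding T2_preordered_def preorder_on_def refl_on_def
  by (auto dest: transD)

lemma T2_preordered_converse:
  assumes "T2_preordered X R"
  shows "T2_preordered X (R\<inverse>)"
proof -
  have "homeomorphic_map (prod_topology X X) (prod_topology X X) (\<lambda>(x, y). (y, x))"
    by (rule homeomorphic_map_swap)
  then have "closedin (prod_topology X X) ((\<lambda>(x, y). (y, x)) ` R)"
    using T2_preorderedD(4)[OF assms] homeomorphic_map_closedness_eq by blast
  moreover have "(\<lambda>(x, y). (y, x)) ` R = R\<inverse>"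
    by auto
  ultimately show ?thesis
    using assms unfolding T2_preordered_def by simp
qed

lemma T2_preordered_subtopology:
  assumes "T2_preordered X R"
  shows "T2_preordered (subtopology X K) (R \<inter> K \<times> K)"
proof -
  note R = T2_preorderedD[OF assms]
  have "closedin (prod_topology (subtopology X K) (subtopology X K)) (R \<inter> K \<times> K)"
    unfolding subtopology_Times[symmetric] using R(4) by (auto simp: closedin_subtopology)
  moreover have "preorder_on (topspace (subtopology X K)) (R \<inter> K \<times> K)"
    unfolding preorder_on_def refl_on_def trans_def using R(1-3) by auto
  ultimately show ?thesis
    unfolding T2_preordered_def by blast
qed

text \<open>The upper set of a compact set \<open>S\<close> is the projection of \<open>R \<inter> S \<times> X\<close> along \<open>S\<close>, and
  projections along compact spaces are closed.\<close>

lemma closedin_inc_hull: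
  assumes R: "T2_preordered X R" and S: "compactin X S"
  shows "closedin X (inc_hull R S)"
proof -
  let ?Y = "subtopology X S"
  have "closed_map (prod_topology ?Y X) X snd"
    using S by (intro Abstract_Topological_Spaces.closed_map_snd) (simp add: compact_space_subtopology)
  moreover have "closedin (prod_topology ?Y X) (S \<times> topspace X \<inter> R)"
    unfolding prod_topology_subtopology
    by (intro closedin_subtopology_Int_closed T2_preorderedD(4)[OF R])
  ultimately have "closedin X (snd ` (S \<times> topspace X \<inter> R))"
    unfolding closed_map_def by blast
  moreover have "snd ` (S \<times> topspace X \<inter> R) = inc_hull R S"
    using T2_preorderedD(1)[OF R] unfolding inc_hull_def by force
  ultimately show ?thesis
    by simp
qed

lemma dec_hull_eq_inc_hull_converse: "dec_hull R S = inc_hull (R\<inverse>) S"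
  by (simp add: dec_hull_def inc_hull_def)

lemma closedin_dec_hull:
  assumes "T2_preordered X R" and "compactin X S"
  shows "closedin X (dec_hull R S)"
  unfolding dec_hull_eq_inc_hull_converse
  by (intro closedin_inc_hull T2_preordered_converse assms)

lemma increasing_set_iff:
  assumes "T2_preordered X R" and "S \<subseteq> topspace X"
  shows "increasing_set R S \<longleftrightarrow> (\<forall>x y. x \<in> S \<longrightarrow> (x, y) \<in> R \<longrightarrow> y \<in> S)"
  using T2_preorderedD(2)[OF assms(1)] assms(2)
  unfolding increasing_set_def inc_hull_def by blast

lemma decreasing_set_iff:
  assumes "T2_preordered X R" and "S \<subseteq> topspace X"
  shows "decreasing_set R S \<longleftrightarrow> (\<forall>x y. y \<in> S \<longrightarrow> (x, y) \<in> R \<longrightarrow> x \<in> S)"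
  using T2_preorderedD(2)[OF assms(1)] assms(2)
  unfolding decreasing_set_def dec_hull_def by blast

lemma increasing_inc_hull:
  assumes "T2_preordered X R" and "S \<subseteq> topspace X"
  shows "increasing_set R (inc_hull R S)"
  using T2_preorderedD(1-3)[OF assms(1)] unfolding increasing_set_def inc_hull_def by blast

lemma decreasing_dec_hull:
  assumes "T2_preordered X R" and "S \<subseteq> topspace X"
  shows "decreasing_set R (dec_hull R S)"
  using T2_preorderedD(1-3)[OF assms(1)] unfolding decreasing_set_def dec_hull_def by blast

lemma increasing_Diff_decreasing:
  assumes "T2_preordered X R" and "decreasing_set R S"
  shows "increasing_set R (topspace X - S)"
  using T2_preorderedD(1,2)[OF assms(1)] assms(2)
  unfolding decreasing_set_def increasing_set_def inc_hull_def dec_hull_def by blast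

lemma decreasing_Diff_increasing:
  assumes "T2_preordered X R" and "increasing_set R S"
  shows "decreasing_set R (topspace X - S)"
  using T2_preorderedD(1,2)[OF assms(1)] assms(2)
  unfolding decreasing_set_def increasing_set_def inc_hull_def dec_hull_def by blast


section \<open>Compact closed preordered spaces\<close>

definition normally_preordered :: "'a topology \<Rightarrow> 'a rel \<Rightarrow> bool" where
  "normally_preordered X R \<longleftrightarrow>
     (\<forall>A B. closedin X A \<and> decreasing_set R A \<and> closedin X B \<and> increasing_set R B \<and> A \<inter> B = {} \<longrightarrow>
        (\<exists>U V. openin X U \<and> decreasing_set R U \<and> openin X V \<and> increasing_set R V \<and>
               A \<subseteq> U \<and> B \<subseteq> V \<and> U \<inter> V = {}))"

lemma normally_preorderedE:
  assumes "normally_preordered X R"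
    and "closedin X A" "decreasing_set R A" "closedin X B" "increasing_set R B" "A \<inter> B = {}"
  obtains U V where "openin X U" "decreasing_set R U" "openin X V" "increasing_set R V"
    "A \<subseteq> U" "B \<subseteq> V" "U \<inter> V = {}"
  using assms unfolding normally_preordered_def by meson

text \<open>Disjointness of a decreasing \<open>A\<close> and an increasing \<open>B\<close> means that no point of \<open>B\<close> lies below a
  point of \<open>A\<close>, that is, \<open>B \<times> A\<close> misses the graph. As the graph is closed and the sets are compact,
  an open box around \<open>B \<times> A\<close> misses it as well.\<close>

lemma compact_imp_normally_preordered:
  assumes R: "T2_preordered Y R" and Y: "compact_space Y"
  shows "normally_preordered Y R"
  unfolding normally_preordered_def
proof (intro allI impI, elim conjE)
  fix A B
  assume A: "closedin Y A" "decreasing_set R A" and B: "closedin Y B" "increasing_set R B"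
    and disj: "A \<inter> B = {}"
  note P = T2_preorderedD[OF R]
  have sub: "A \<subseteq> topspace Y" "B \<subseteq> topspace Y"
    using A B closedin_subset by auto
  have comp: "compactin Y S" if "closedin Y S" for S
    using that Y closedin_compact_space by blast
  have "openin (prod_topology Y Y) (topspace Y \<times> topspace Y - R)"
    using P(4) by (metis openin_diff openin_topspace topspace_prod_topology)
  moreover have "B \<times> A \<subseteq> topspace Y \<times> topspace Y - R"
    using disj sub B(2) increasing_set_iff[OF R] by blast
  ultimately obtain N M where NM: "openin Y N" "openin Y M" "B \<subseteq> N" "A \<subseteq> M"
    "N \<times> M \<subseteq> topspace Y \<times> topspace Y - R"
    using Wallace_theorem_prod_topology[OF comp[OF B(1)] comp[OF A(1)]] by metis
  \<comment> \<open>The largest decreasing subset of \<open>M\<close> and the largest increasing subset of \<open>N\<close>.\<close>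
  define U where "U = topspace Y - inc_hull R (topspace Y - M)"
  define V where "V = topspace Y - dec_hull R (topspace Y - N)"
  have "openin Y U" "openin Y V"
    unfolding U_def V_def using NM(1,2) R comp
    by (auto intro!: openin_diff closedin_inc_hull closedin_dec_hull)
  moreover have "decreasing_set R U" "increasing_set R V"
    unfolding U_def V_def
    by (auto intro!: decreasing_Diff_increasing increasing_Diff_decreasing
        increasing_inc_hull decreasing_dec_hull R)
  moreover have "A \<subseteq> U"
    using NM(4) sub A(2) decreasing_set_iff[OF R sub(1)] unfolding U_def inc_hull_def by blast
  moreover have "B \<subseteq> V"
    using NM(3) sub B(2) increasing_set_iff[OF R sub(2)] unfolding V_def dec_hull_def by blast
  moreover have "U \<inter> V = {}"
  proof -
    have "U \<subseteq> M" "V \<subseteq> N"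
      unfolding U_def V_def inc_hull_def dec_hull_def using P(2) by blast+
    then show ?thesis
      using NM(5) P(2) by blast
  qed
  ultimately show "\<exists>U V. openin Y U \<and> decreasing_set R U \<and> openin Y V \<and> increasing_set R V \<and>
               A \<subseteq> U \<and> B \<subseteq> V \<and> U \<inter> V = {}"
    by blast
qed

text \<open>As \<open>B\<close> is increasing, it misses \<open>dec_hull R S\<close> together with \<open>S\<close>, so normality applies to
  these two sets.\<close>

lemma closed_increasing_neighbourhood:
  assumes R: "T2_preordered Y R" and Y: "compact_space Y"
    and B: "closedin Y B" "increasing_set R B" and S: "closedin Y S" "S \<inter> B = {}"
  obtains N B' where "openin Y N" "closedin Y B'" "increasing_set R B'" "B \<subseteq> N" "N \<subseteq> B'"
    "S \<inter> B' = {}"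
proof -
  have sub: "B \<subseteq> topspace Y" "S \<subseteq> topspace Y"
    using B S closedin_subset by auto
  have "closedin Y (dec_hull R S)" "decreasing_set R (dec_hull R S)"
    using S(1) Y sub(2) by (auto intro!: closedin_dec_hull decreasing_dec_hull R closedin_compact_space)
  moreover have "dec_hull R S \<inter> B = {}"
    using S(2) B(2) increasing_set_iff[OF R sub(1)] unfolding dec_hull_def by blast
  ultimately obtain U V where UV: "openin Y U" "decreasing_set R U" "openin Y V"
    "dec_hull R S \<subseteq> U" "B \<subseteq> V" "U \<inter> V = {}"
    using normally_preorderedE[OF compact_imp_normally_preordered[OF R Y]] B by metis
  show thesis
  proof (rule that[of V "topspace Y - U"])
    show "closedin Y (topspace Y - U)"
      using UV(1) by blast
    show "S \<inter> (topspace Y - U) = {}"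
      using UV(4) sub(2) T2_preorderedD(2)[OF R] unfolding dec_hull_def by blast
  qed (use UV R openin_subset[OF UV(3)] in \<open>auto intro!: increasing_Diff_decreasing\<close>)
qed

lemma increasing_set_converse: "increasing_set (R\<inverse>) S = decreasing_set R S"
  by (simp add: increasing_set_def decreasing_set_def dec_hull_eq_inc_hull_converse)

text \<open>Enlarge \<open>B\<close> away from the part of \<open>A\<close> outside \<open>W\<close>, and then \<open>A\<close> away from
  the part outside \<open>W\<close> of the enlarged \<open>B\<close>.\<close>

lemma compact_closed_monotone_neighbourhoods:
  assumes R: "T2_preordered Y R" and Y: "compact_space Y"
    and A: "closedin Y A" "decreasing_set R A" and B: "closedin Y B" "increasing_set R B"
    and W: "openin Y W" "A \<inter> B \<subseteq> W"
  obtains M A' N B' where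
    "openin Y M" "closedin Y A'" "decreasing_set R A'" "A \<subseteq> M" "M \<subseteq> A'"
    "openin Y N" "closedin Y B'" "increasing_set R B'" "B \<subseteq> N" "N \<subseteq> B'" "A' \<inter> B' \<subseteq> W"
proof -
  obtain N B' where N: "openin Y N" "closedin Y B'" "increasing_set R B'" "B \<subseteq> N" "N \<subseteq> B'"
    "(A - W) \<inter> B' = {}"
    using closed_increasing_neighbourhood[OF R Y B, of "A - W"] W A(1) by blast
  have BW: "closedin Y (B' - W)" "(B' - W) \<inter> A = {}"
    using N W(1) by (blast intro: closedin_diff)+
  obtain M A' where M: "openin Y M" "closedin Y A'" "increasing_set (R\<inverse>) A'" "A \<subseteq> M" "M \<subseteq> A'"
    "(B' - W) \<inter> A' = {}"
    using closed_increasing_neighbourhood[OF T2_preordered_converse[OF R] Y A(1) _ BW]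
      A(2) increasing_set_converse by blast
  have "A' \<inter> B' \<subseteq> W"
    using M(6) by blast
  then show thesis
    using that[of M A' N B'] N M by (simp add: increasing_set_converse)
qed


section \<open>Extension along a compact exhaustion\<close>

text \<open>An increasing witness for the k-omega property. The condition on open sets is stated in its
  nontrivial direction.\<close>

definition compact_exhaustion :: "'a topology \<Rightarrow> (nat \<Rightarrow> 'a set) \<Rightarrow> bool" where
  "compact_exhaustion X K \<longleftrightarrow>
     (\<forall>n. compactin X (K n)) \<and> incseq K \<and> (\<Union>n. K n) = topspace X \<and>
     (\<forall>U. U \<subseteq> topspace X \<longrightarrow> (\<forall>n. openin (subtopology X (K n)) (U \<inter> K n)) \<longrightarrow> openin X U)"

lemma compact_exhaustion_enlarge:
  assumes k: "\<And>n. compactin X (K n)" "(\<Union>n. K n) = topspace X"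
     "\<And>U. U \<subseteq> topspace X \<Longrightarrow> (\<And>n. openin (subtopology X (K n)) (U \<inter> K n)) \<Longrightarrow> openin X U"
   and L: "\<And>n. compactin X (L n)" "incseq L" "\<And>n. K n \<subseteq> L n"
  shows "compact_exhaustion X L"
  unfolding compact_exhaustion_def
proof (intro conjI allI impI)
  have "(\<Union>n. L n) \<subseteq> topspace X"
    using compactin_subset_topspace[OF L(1)] by blast
  moreover have "(\<Union>n. K n) \<subseteq> (\<Union>n. L n)"
    using L(3) by (rule UN_mono[OF subset_refl])
  ultimately show "(\<Union>n. L n) = topspace X"
    unfolding k(2) by (rule subset_antisym)
  fix U assume U: "U \<subseteq> topspace X" "\<forall>n. openin (subtopology X (L n)) (U \<inter> L n)"
  show "openin X U"
  proof (rule k(3)[OF U(1)])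
    fix n
    obtain T where "openin X T" "U \<inter> L n = T \<inter> L n"
      using U(2) unfolding openin_subtopology by blast
    then have "openin X T" "U \<inter> K n = T \<inter> K n"
      using L(3)[of n] by blast+
    then show "openin (subtopology X (K n)) (U \<inter> K n)"
      unfolding openin_subtopology by blast
  qed
qed (rule L)+

lemma k_omega_space_compact_exhaustion:
  assumes "k_omega_space X"
  obtains K where "compact_exhaustion X K"
proof -
  obtain K :: "nat \<Rightarrow> 'a set" where K: "\<And>i. compactin X (K i)" "(\<Union>i. K i) = topspace X"
     "\<And>U. U \<subseteq> topspace X \<Longrightarrow> (\<And>n. openin (subtopology X (K n)) (U \<inter> K n)) \<Longrightarrow> openin X U"
    using assms unfolding k_omega_space_def by metis
  have "compact_exhaustion X (\<lambda>n. \<Union>(K ` {..n}))"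
  proof (rule compact_exhaustion_enlarge[OF K])
    show "incseq (\<lambda>n. \<Union>(K ` {..n}))"
      unfolding incseq_def by (auto intro: order_trans)
  qed (use K(1) in \<open>auto intro!: compactin_Union\<close>)
  then show thesis
    using that by blast
qed

text \<open>The union is open because \<open>A (Suc m)\<close> contains a relatively open neighbourhood of \<open>A m\<close>
  in \<open>K (Suc m)\<close>, hence in every smaller \<open>K n\<close>.\<close>

lemma open_decreasing_Union_of_neighbourhoods:
  assumes R: "T2_preordered X R" and K: "compact_exhaustion X K"
    and A: "\<And>n. A n \<subseteq> K n" "\<And>n. dec_hull R (A n) \<inter> K n \<subseteq> A n"
    and M: "\<And>n. openin (subtopology X (K (Suc n))) (M n)" "\<And>n. A n \<subseteq> M n" "\<And>n. M n \<subseteq> A (Suc n)"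
  shows "openin X (\<Union>n. A n)" "decreasing_set R (\<Union>n. A n)"
proof -
  have inc: "A m \<subseteq> A n" if "m \<le> n" for m n
    using lift_Suc_mono_le[of A, OF _ that] M(2,3) by blast
  have Kinc: "K m \<subseteq> K n" if "m \<le> n" for m n
    using K that unfolding compact_exhaustion_def incseq_def by blast
  have Kun: "(\<Union>n. K n) = topspace X"
    using K unfolding compact_exhaustion_def by blast
  have sub: "(\<Union>n. A n) \<subseteq> topspace X"
    using A(1) Kun by blast
  have "openin (subtopology X (K n)) ((\<Union>n. A n) \<inter> K n)" for n
  proof (subst openin_subopen, intro ballI)
    fix p assume "p \<in> (\<Union>n. A n) \<inter> K n"
    then obtain m where m: "p \<in> A m" "p \<in> K n"
      by blast
    define k where "k = max m n"
    have "p \<in> M k"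
      using inc[of m k] m M(2) unfolding k_def by auto
    obtain T where T: "openin X T" "M k = T \<inter> K (Suc k)"
      using M(1) unfolding openin_subtopology by blast
    have "K n \<subseteq> K (Suc k)"
      by (rule Kinc) (simp add: k_def)
    then have "M k \<inter> K n = T \<inter> K n"
      using T(2) by blast
    then have "openin (subtopology X (K n)) (M k \<inter> K n)"
      using T(1) unfolding openin_subtopology by blast
    moreover have "M k \<inter> K n \<subseteq> (\<Union>n. A n) \<inter> K n"
      using M(3) by blast
    ultimately show "\<exists>T. openin (subtopology X (K n)) T \<and> p \<in> T \<and> T \<subseteq> (\<Union>n. A n) \<inter> K n"
      using m \<open>p \<in> M k\<close> by blast
  qed
  then show "openin X (\<Union>n. A n)"
    using K sub unfolding compact_exhaustion_def by blast
  show "decreasing_set R (\<Union>n. A n)"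
    unfolding decreasing_set_iff[OF R sub]
  proof (intro allI impI)
    fix x y assume y: "y \<in> (\<Union>n. A n)" and xy: "(x, y) \<in> R"
    then obtain m where m: "y \<in> A m"
      by blast
    obtain n where n: "x \<in> K n"
      using xy T2_preorderedD(1)[OF R] Kun by blast
    have "x \<in> K (max m n)" "y \<in> A (max m n)"
      using Kinc[of n "max m n"] inc[of m "max m n"] m n by auto
    then have "x \<in> A (max m n)"
      using A(2) xy unfolding dec_hull_def by blast
    then show "x \<in> (\<Union>n. A n)"
      by blast
  qed
qed

text \<open>The neighbourhood lemma for compact spaces, read in a compact subset \<open>K\<close> of \<open>X\<close>.\<close>

lemma compactin_closed_monotone_neighbourhoods:
  assumes R: "T2_preordered X R" and K: "compactin X K"
    and A: "closedin X A" "decreasing_set R A" and B: "closedin X B" "increasing_set R B"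
    and W: "openin X W" "A \<inter> B \<inter> K \<subseteq> W"
  obtains M A' N B' where
    "openin (subtopology X K) M" "compactin X A'" "A' \<subseteq> K" "dec_hull R A' \<inter> K \<subseteq> A'"
    "A \<inter> K \<subseteq> M" "M \<subseteq> A'"
    "openin (subtopology X K) N" "compactin X B'" "B' \<subseteq> K" "inc_hull R B' \<inter> K \<subseteq> B'"
    "B \<inter> K \<subseteq> N" "N \<subseteq> B'" "A' \<inter> B' \<subseteq> W"
proof -
  let ?Y = "subtopology X K" and ?R = "R \<inter> K \<times> K"
  have R': "T2_preordered ?Y ?R"
    by (rule T2_preordered_subtopology[OF R])
  have Y: "compact_space ?Y"
    using K compact_space_subtopology by blast
  have sub: "A \<subseteq> topspace X" "B \<subseteq> topspace X"
    using A B closedin_subset by auto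
  have A': "closedin ?Y (A \<inter> K)" "decreasing_set ?R (A \<inter> K)"
    using A sub decreasing_set_iff[OF R sub(1)] decreasing_set_iff[OF R', of "A \<inter> K"]
    by (auto simp: closedin_subtopology)
  have B': "closedin ?Y (B \<inter> K)" "increasing_set ?R (B \<inter> K)"
    using B sub increasing_set_iff[OF R sub(2)] increasing_set_iff[OF R', of "B \<inter> K"]
    by (auto simp: closedin_subtopology)
  have W': "openin ?Y (W \<inter> K)" "A \<inter> K \<inter> (B \<inter> K) \<subseteq> W \<inter> K"
    using W by (auto simp: openin_subtopology)
  obtain M A1 N B1 where *:
    "openin ?Y M" "closedin ?Y A1" "decreasing_set ?R A1" "A \<inter> K \<subseteq> M" "M \<subseteq> A1"
    "openin ?Y N" "closedin ?Y B1" "increasing_set ?R B1" "B \<inter> K \<subseteq> N" "N \<subseteq> B1" "A1 \<inter> B1 \<subseteq> W \<inter> K"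
    using compact_closed_monotone_neighbourhoods[OF R' Y A' B' W'] .
  have comp: "compactin X S" "S \<subseteq> K" if "closedin ?Y S" for S
    using closedin_compact_space[OF Y that] by (auto simp: compactin_subtopology)
  have "dec_hull R A1 \<inter> K \<subseteq> A1" "inc_hull R B1 \<inter> K \<subseteq> B1"
    using *(3,8) comp(2)[OF *(2)] comp(2)[OF *(7)]
    unfolding decreasing_set_def increasing_set_def dec_hull_def inc_hull_def by blast+
  then show thesis
    using that[of M A1 N B1] * comp by blast
qed

text \<open>
  Starting from \<open>A\<close> and \<open>B\<close> in \<open>K 0\<close>, the compact neighbourhoods found in \<open>K n\<close>
  are closed up to \<open>dec_hull R S \<union> A\<close> and \<open>inc_hull R T \<union> B\<close> in \<open>X\<close>, and the result is enlarged
  in \<open>K (Suc n)\<close>. The hypothesis \<open>closing_up\<close> says that closing up does not leave \<open>W\<close>. It holds for two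
  unrelated reasons in the two applications: for \<open>W = {}\<close> by transitivity, which gives
  normality, and for \<open>A\<close> and \<open>B\<close> the hulls of a point when the \<open>K n\<close> are convex, which gives
  convexity.
\<close>

lemma monotone_neighbourhoods_by_exhaustion:
  assumes R: "T2_preordered X R" and K: "compact_exhaustion X K"
    and A: "closedin X A" "decreasing_set R A" and B: "closedin X B" "increasing_set R B"
    and W: "openin X W" "A \<inter> B \<subseteq> W"
    and closing_up: "\<And>n S T. \<lbrakk>S \<subseteq> K n; T \<subseteq> K n; A \<inter> K n \<subseteq> S; B \<inter> K n \<subseteq> T;
        dec_hull R S \<inter> inc_hull R T \<inter> K n \<subseteq> W\<rbrakk>
      \<Longrightarrow> (dec_hull R S \<union> A) \<inter> (inc_hull R T \<union> B) \<subseteq> W"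
  obtains U V where "openin X U" "decreasing_set R U" "A \<subseteq> U"
    "openin X V" "increasing_set R V" "B \<subseteq> V" "U \<inter> V \<subseteq> W"
proof -
  have Kc: "compactin X (K n)" for n
    using K unfolding compact_exhaustion_def by blast
  have Kinc: "K m \<subseteq> K n" if "m \<le> n" for m n
    using K that unfolding compact_exhaustion_def incseq_def by blast
  have Kun: "(\<Union>n. K n) = topspace X"
    using K unfolding compact_exhaustion_def by blast
  define P where "P n ST \<longleftrightarrow> (case ST of (S, T) \<Rightarrow>
      compactin X S \<and> S \<subseteq> K n \<and> dec_hull R S \<inter> K n \<subseteq> S \<and> A \<inter> K n \<subseteq> S \<and>
      compactin X T \<and> T \<subseteq> K n \<and> inc_hull R T \<inter> K n \<subseteq> T \<and> B \<inter> K n \<subseteq> T \<and> S \<inter> T \<subseteq> W)" for n ST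
  define Q where "Q n ST ST' \<longleftrightarrow> (case (ST, ST') of ((S, T), (S', T')) \<Rightarrow>
      (\<exists>M. openin (subtopology X (K (Suc n))) M \<and> S \<subseteq> M \<and> M \<subseteq> S') \<and>
      (\<exists>N. openin (subtopology X (K (Suc n))) N \<and> T \<subseteq> N \<and> N \<subseteq> T'))" for n ST ST'
  have "\<exists>ST. P 0 ST"
  proof -
    have "A \<inter> B \<inter> K 0 \<subseteq> W"
      using W(2) by blast
    from compactin_closed_monotone_neighbourhoods[OF R Kc A B W(1) this]
    obtain M A' N B' where *: "openin (subtopology X (K 0)) M" "compactin X A'" "A' \<subseteq> K 0"
      "dec_hull R A' \<inter> K 0 \<subseteq> A'" "A \<inter> K 0 \<subseteq> M" "M \<subseteq> A'"
      "openin (subtopology X (K 0)) N" "compactin X B'" "B' \<subseteq> K 0"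
      "inc_hull R B' \<inter> K 0 \<subseteq> B'" "B \<inter> K 0 \<subseteq> N" "N \<subseteq> B'" "A' \<inter> B' \<subseteq> W" .
    then have "A \<inter> K 0 \<subseteq> A'" "B \<inter> K 0 \<subseteq> B'"
      by blast+
    then have "P 0 (A', B')"
      unfolding P_def using * by simp
    then show ?thesis ..
  qed
  moreover have "\<exists>ST'. P (Suc n) ST' \<and> Q n ST ST'" if PST: "P n ST" for n ST
  proof -
    obtain S T where ST: "ST = (S, T)"
      by (cases ST)
    have S: "compactin X S" "S \<subseteq> K n" "dec_hull R S \<inter> K n \<subseteq> S" "A \<inter> K n \<subseteq> S"
      and T: "compactin X T" "T \<subseteq> K n" "inc_hull R T \<inter> K n \<subseteq> T" "B \<inter> K n \<subseteq> T"
      and disj: "S \<inter> T \<subseteq> W"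
      using PST unfolding P_def ST by auto
    have sub: "S \<subseteq> topspace X" "T \<subseteq> topspace X"
      using S(1) T(1) compactin_subset_topspace by blast+
    have hull: "S \<subseteq> dec_hull R S" "T \<subseteq> inc_hull R T"
      using sub T2_preorderedD(2)[OF R] unfolding dec_hull_def inc_hull_def by blast+
    have "(dec_hull R S \<union> A) \<inter> (inc_hull R T \<union> B) \<subseteq> W"
      by (rule closing_up[OF S(2) T(2) S(4) T(4)]) (use S(3) T(3) disj in blast)
    then have W': "(dec_hull R S \<union> A) \<inter> (inc_hull R T \<union> B) \<inter> K (Suc n) \<subseteq> W"
      by blast
    have cl: "closedin X (dec_hull R S \<union> A)" "closedin X (inc_hull R T \<union> B)"
      using A B R S T by (auto intro!: closedin_Un closedin_dec_hull closedin_inc_hull)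
    have mon: "decreasing_set R (dec_hull R S \<union> A)" "increasing_set R (inc_hull R T \<union> B)"
      using decreasing_dec_hull[OF R sub(1)] A(2) increasing_inc_hull[OF R sub(2)] B(2)
      unfolding decreasing_set_def increasing_set_def
      by (auto simp: dec_hull_def inc_hull_def Image_Un)
    from compactin_closed_monotone_neighbourhoods[OF R Kc cl(1) mon(1) cl(2) mon(2) W(1) W']
    obtain M A' N B' where *:
      "openin (subtopology X (K (Suc n))) M" "compactin X A'" "A' \<subseteq> K (Suc n)"
      "dec_hull R A' \<inter> K (Suc n) \<subseteq> A'" "(dec_hull R S \<union> A) \<inter> K (Suc n) \<subseteq> M" "M \<subseteq> A'"
      "openin (subtopology X (K (Suc n))) N" "compactin X B'" "B' \<subseteq> K (Suc n)"
      "inc_hull R B' \<inter> K (Suc n) \<subseteq> B'" "(inc_hull R T \<union> B) \<inter> K (Suc n) \<subseteq> N" "N \<subseteq> B'"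
      "A' \<inter> B' \<subseteq> W" .
    have "K n \<subseteq> K (Suc n)"
      by (rule Kinc) simp
    then have "S \<subseteq> M" "T \<subseteq> N"
      using *(5,11) hull S(2) T(2) by blast+
    then have "Q n ST (A', B')"
      unfolding Q_def ST using *(1,6,7,12) by auto
    moreover have "A \<inter> K (Suc n) \<subseteq> A'" "B \<inter> K (Suc n) \<subseteq> B'"
      using *(5,6,11,12) by blast+
    then have "P (Suc n) (A', B')"
      unfolding P_def using *(2-4,8-10,13) by simp
    ultimately have "P (Suc n) (A', B') \<and> Q n ST (A', B')"
      by blast
    then show ?thesis ..
  qed
  ultimately obtain F where F: "\<And>n. P n (F n)" "\<And>n. Q n (F n) (F (Suc n))"
    using dependent_nat_choice[of P Q] by metis
  define S where "S n = fst (F n)" for n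
  define T where "T n = snd (F n)" for n
  have S: "S n \<subseteq> K n" "dec_hull R (S n) \<inter> K n \<subseteq> S n" "A \<inter> K n \<subseteq> S n"
    and T: "T n \<subseteq> K n" "dec_hull (R\<inverse>) (T n) \<inter> K n \<subseteq> T n" "B \<inter> K n \<subseteq> T n"
    and ST: "S n \<inter> T n \<subseteq> W" for n
    using F(1)[of n] unfolding P_def S_def T_def case_prod_unfold
    by (simp_all add: dec_hull_eq_inc_hull_converse)
  obtain M N where M: "\<And>n. openin (subtopology X (K (Suc n))) (M n)" "\<And>n. S n \<subseteq> M n"
      "\<And>n. M n \<subseteq> S (Suc n)"
    and N: "\<And>n. openin (subtopology X (K (Suc n))) (N n)" "\<And>n. T n \<subseteq> N n"
      "\<And>n. N n \<subseteq> T (Suc n)"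
    using F(2) unfolding Q_def S_def T_def case_prod_unfold fst_conv snd_conv by metis
  show thesis
  proof (rule that[of "\<Union>n. S n" "\<Union>n. T n"])
    show "openin X (\<Union>n. S n)" "decreasing_set R (\<Union>n. S n)"
      using open_decreasing_Union_of_neighbourhoods[OF R K S(1,2) M] .
    show "openin X (\<Union>n. T n)" "increasing_set R (\<Union>n. T n)"
      using open_decreasing_Union_of_neighbourhoods[OF T2_preordered_converse[OF R] K T(1,2) N]
        increasing_set_converse[of "R\<inverse>"] by auto
    have "A \<inter> (\<Union>n. K n) \<subseteq> (\<Union>n. S n)" "B \<inter> (\<Union>n. K n) \<subseteq> (\<Union>n. T n)"
      unfolding Int_UN_distrib by (intro UN_mono[OF subset_refl] S(3) T(3))+
    then show "A \<subseteq> (\<Union>n. S n)" "B \<subseteq> (\<Union>n. T n)"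
      using closedin_subset[OF A(1)] closedin_subset[OF B(1)] by (simp_all add: Kun Int_absorb2)
    have mono: "S m \<subseteq> S n" "T m \<subseteq> T n" if "m \<le> n" for m n
      by (rule lift_Suc_mono_le[OF _ that], rule subset_trans[OF M(2,3)] subset_trans[OF N(2,3)])+
    show "(\<Union>n. S n) \<inter> (\<Union>n. T n) \<subseteq> W"
    proof
      fix p assume "p \<in> (\<Union>n. S n) \<inter> (\<Union>n. T n)"
      then obtain m n where "p \<in> S m" "p \<in> T n"
        by blast
      then have "p \<in> S (max m n) \<inter> T (max m n)"
        using mono[of m "max m n"] mono[of n "max m n"] by auto
      then show "p \<in> W"
        using ST by blast
    qed
  qed
qed


section \<open>Normality and convexity\<close>

text \<open>Here \<open>closing_up\<close> holds with \<open>W = {}\<close>: a chain \<open>t \<le> p \<le> s\<close> with \<open>t \<in> T\<close> and \<open>s \<in> S\<close> would put \<open>t\<close>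
  itself into \<open>dec_hull R S \<inter> inc_hull R T \<inter> K n\<close>. Points of \<open>A\<close> and \<open>B\<close> outside \<open>K n\<close> do no harm:
  a point of \<open>A\<close> above \<open>t \<in> T\<close> forces \<open>t \<in> A \<inter> K n \<subseteq> S\<close>.\<close>

lemma k_omega_imp_normally_preordered:
  assumes R: "T2_preordered X R" and X: "k_omega_space X"
  shows "normally_preordered X R"
  unfolding normally_preordered_def
proof (intro allI impI, elim conjE)
  fix A B
  assume A: "closedin X A" "decreasing_set R A" and B: "closedin X B" "increasing_set R B"
    and disj: "A \<inter> B = {}"
  obtain K where K: "compact_exhaustion X K"
    using k_omega_space_compact_exhaustion[OF X] .
  have KX: "K n \<subseteq> topspace X" for n
    using K unfolding compact_exhaustion_def by blast
  have "(dec_hull R S \<union> A) \<inter> (inc_hull R T \<union> B) \<subseteq> {}"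
    if "S \<subseteq> K n" "T \<subseteq> K n" "A \<inter> K n \<subseteq> S" "B \<inter> K n \<subseteq> T"
       "dec_hull R S \<inter> inc_hull R T \<inter> K n \<subseteq> {}" for n S T
  proof -
    note P = T2_preorderedD[OF R]
    have st: "(t, s) \<notin> R" if "s \<in> S" "t \<in> T" for s t
      using that \<open>dec_hull R S \<inter> inc_hull R T \<inter> K n \<subseteq> {}\<close> P(2) KX \<open>T \<subseteq> K n\<close>
      unfolding dec_hull_def inc_hull_def by blast
    have 1: "dec_hull R S \<inter> inc_hull R T = {}"
      using st P(3) unfolding dec_hull_def inc_hull_def by blast
    have "A \<inter> T = {}"
      using st P(2) KX that by blast
    then have 2: "A \<inter> inc_hull R T = {}"
      using decreasing_set_iff[OF R closedin_subset[OF A(1)]] A(2) unfolding inc_hull_def by blast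
    have "B \<inter> S = {}"
      using st P(2) KX that by blast
    then have 3: "dec_hull R S \<inter> B = {}"
      using increasing_set_iff[OF R closedin_subset[OF B(1)]] B(2) unfolding dec_hull_def by blast
    show ?thesis
      using 1 2 3 disj by blast
  qed
  then obtain U V where "openin X U" "decreasing_set R U" "A \<subseteq> U"
    "openin X V" "increasing_set R V" "B \<subseteq> V" "U \<inter> V \<subseteq> {}"
    using monotone_neighbourhoods_by_exhaustion[OF R K A B openin_empty] disj
    by (metis (no_types, lifting) order_refl)
  then show "\<exists>U V. openin X U \<and> decreasing_set R U \<and> openin X V \<and> increasing_set R V \<and>
               A \<subseteq> U \<and> B \<subseteq> V \<and> U \<inter> V = {}"
    by blast
qed

text \<open>Convex hulls of compact sets are compact, so the members of an exhaustion can be replaced by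
  the convex hulls of their unions with \<open>{x}\<close>.\<close>

lemma k_preserving_compact_exhaustion:
  assumes R: "T2_preordered X R" and k: "k_preserving X R" and X: "k_omega_space X"
    and x: "x \<in> topspace X"
  obtains L where "compact_exhaustion X L" "\<And>n. x \<in> L n"
    "\<And>n. dec_hull R (L n) \<inter> inc_hull R (L n) \<subseteq> L n"
proof -
  note P = T2_preorderedD[OF R]
  obtain K where K: "compact_exhaustion X K"
    using k_omega_space_compact_exhaustion[OF X] .
  then have Kc: "compactin X (K n)" and inc: "incseq K" for n
    unfolding compact_exhaustion_def by auto
  define C where "C n = insert x (K n)" for n
  define L where "L n = dec_hull R (C n) \<inter> inc_hull R (C n)" for n
  have C: "compactin X (C n)" for n
    using compactin_Un[OF _ Kc, of "{x}"] x unfolding C_def by simp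
  have CL: "C n \<subseteq> L n" for n
    using compactin_subset_topspace[OF C[of n]] P(2)
    unfolding L_def dec_hull_def inc_hull_def by blast
  show thesis
  proof (rule that[of L])
    show "compact_exhaustion X L"
    proof (rule compact_exhaustion_enlarge[of X K])
      show "compactin X (L n)" for n
        using k C unfolding k_preserving_def L_def by blast
      show "incseq L"
        using inc unfolding incseq_def L_def C_def dec_hull_def inc_hull_def by blast
      show "K n \<subseteq> L n" for n
        using CL unfolding C_def by blast
    qed (use K in \<open>auto simp: compact_exhaustion_def\<close>)
    show "x \<in> L n" for n
      using CL unfolding C_def by blast
    show "dec_hull R (L n) \<inter> inc_hull R (L n) \<subseteq> L n" for n
      unfolding L_def dec_hull_def inc_hull_def using P(3) by blast
  qed
qed

lemma convex_at_of_class_indistinguishable: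
  assumes R: "T2_preordered X R" and k: "k_preserving X R" and X: "k_omega_space X"
    and x: "x \<in> topspace X" and ind: "class_indistinguishable_at X R x"
  shows "convex_at X R x"
  unfolding convex_at_def
proof (intro allI impI, elim conjE)
  fix W assume W: "openin X W" "x \<in> W"
  note P = T2_preorderedD[OF R]
  obtain L where L: "compact_exhaustion X L" "\<And>n. x \<in> L n"
    "\<And>n. dec_hull R (L n) \<inter> inc_hull R (L n) \<subseteq> L n"
    using k_preserving_compact_exhaustion[OF R k X x] by metis
  have xx: "compactin X {x}" "{x} \<subseteq> topspace X"
    using x by auto
  note A = closedin_dec_hull[OF R xx(1)] decreasing_dec_hull[OF R xx(2)]
  note B = closedin_inc_hull[OF R xx(1)] increasing_inc_hull[OF R xx(2)]
  have self: "x \<in> dec_hull R {x}" "x \<in> inc_hull R {x}"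
    using P(2)[OF x] unfolding dec_hull_def inc_hull_def by auto
  have "order_class R x \<subseteq> W"
    using ind W self unfolding class_indistinguishable_at_def order_class_def by blast
  then have AB: "dec_hull R {x} \<inter> inc_hull R {x} \<subseteq> W"
    unfolding order_class_def .
  have "(dec_hull R S \<union> dec_hull R {x}) \<inter> (inc_hull R T \<union> inc_hull R {x}) \<subseteq> W"
    if "S \<subseteq> L n" "T \<subseteq> L n" "dec_hull R {x} \<inter> L n \<subseteq> S" "inc_hull R {x} \<inter> L n \<subseteq> T"
       "dec_hull R S \<inter> inc_hull R T \<inter> L n \<subseteq> W" for n S T
  proof -
    have "x \<in> S" "x \<in> T"
      using that self L(2) by blast+
    \<comment> \<open>The hulls of \<open>S\<close> and \<open>T\<close> absorb those of \<open>x\<close>, and they meet inside the convex \<open>L n\<close>.\<close>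
    then have "(dec_hull R S \<union> dec_hull R {x}) \<inter> (inc_hull R T \<union> inc_hull R {x})
        = dec_hull R S \<inter> inc_hull R T"
      unfolding dec_hull_def inc_hull_def by blast
    moreover have "dec_hull R S \<inter> inc_hull R T \<subseteq> L n"
      using L(3)[of n] that(1,2) unfolding dec_hull_def inc_hull_def by blast
    ultimately show ?thesis
      using that(5) by blast
  qed
  then obtain U V where "openin X U" "decreasing_set R U" "dec_hull R {x} \<subseteq> U"
    "openin X V" "increasing_set R V" "inc_hull R {x} \<subseteq> V" "U \<inter> V \<subseteq> W"
    using monotone_neighbourhoods_by_exhaustion[OF R L(1) A B W(1) AB] by (metis (no_types, lifting))
  then show "\<exists>U V. openin X U \<and> decreasing_set R U \<and> openin X V \<and> increasing_set R V \<and>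
               x \<in> U \<inter> V \<and> U \<inter> V \<subseteq> W"
    using self by blast
qed

lemma antisymmetric_imp_class_indistinguishable:
  "antisymmetric_at R x \<Longrightarrow> class_indistinguishable_at X R x"
  unfolding antisymmetric_at_def class_indistinguishable_at_def by auto

text \<open>Replace each compact set of a countable cover by a compact neighbourhood \<open>L i\<close> of it. The
  interiors of the \<open>L i\<close> then cover the space, so openness can be tested on the \<open>L i\<close>.\<close>

lemma locally_compact_sigma_compact_imp_k_omega:
  assumes lc: "locally_compact_space X" and sc: "sigma_compact_space X"
  shows "k_omega_space X"
proof -
  obtain K :: "nat \<Rightarrow> 'a set" where K: "\<And>i. compactin X (K i)" "(\<Union>i. K i) = topspace X"
    using sc unfolding sigma_compact_space_def by blast
  have "\<exists>G L. openin X G \<and> compactin X L \<and> C \<subseteq> G \<and> G \<subseteq> L" if C: "compactin X C" for C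
  proof -
    obtain N L where OL: "openin X (N x)" "compactin X (L x)" "x \<in> N x" "N x \<subseteq> L x"
      if "x \<in> topspace X" for x
      using lc unfolding locally_compact_space_def by metis
    have CX: "C \<subseteq> topspace X"
      using C compactin_subset_topspace by blast
    have "\<exists>\<F>. finite \<F> \<and> \<F> \<subseteq> N ` C \<and> C \<subseteq> \<Union>\<F>"
    proof (rule compactinD[OF C])
      show "openin X U" if "U \<in> N ` C" for U
        using that OL(1) CX by auto
      show "C \<subseteq> \<Union>(N ` C)"
        using OL(3) CX by auto
    qed
    then obtain D where D: "finite D" "D \<subseteq> C" "C \<subseteq> \<Union>(N ` D)"
      by (metis finite_subset_image)
    have DX: "x \<in> topspace X" if "x \<in> D" for x
      using that D(2) CX by auto
    have "openin X (\<Union>(N ` D))"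
      using OL(1) DX by (intro openin_Union) auto
    moreover have "compactin X (\<Union>(L ` D))"
      using D(1) OL(2) DX by (intro compactin_Union) auto
    moreover have "\<Union>(N ` D) \<subseteq> \<Union>(L ` D)"
      using OL(4) DX by (intro UN_mono) auto
    ultimately show ?thesis
      using D(3) by (intro exI conjI)
  qed
  then have "\<exists>G L. openin X G \<and> compactin X L \<and> K i \<subseteq> G \<and> G \<subseteq> L" for i
    using K(1) .
  then obtain G L where GL: "\<And>i. openin X (G i)" "\<And>i. compactin X (L i)"
    "\<And>i. K i \<subseteq> G i" "\<And>i. G i \<subseteq> L i"
    by metis
  have "(\<Union>i. L i) \<subseteq> topspace X"
    using compactin_subset_topspace[OF GL(2)] by blast
  moreover have "(\<Union>i. K i) \<subseteq> (\<Union>i. L i)"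
    by (intro UN_mono[OF subset_refl] subset_trans[OF GL(3,4)])
  ultimately have "(\<Union>i. L i) = topspace X"
    unfolding K(2) by (rule subset_antisym)
  moreover have "openin X U \<longleftrightarrow> (\<forall>i. openin (subtopology X (L i)) (U \<inter> L i))"
    if U: "U \<subseteq> topspace X" for U
  proof
    assume "openin X U"
    then show "\<forall>i. openin (subtopology X (L i)) (U \<inter> L i)"
      by (auto simp: openin_subtopology)
  next
    assume *: "\<forall>i. openin (subtopology X (L i)) (U \<inter> L i)"
    have "openin X (U \<inter> G i)" for i
    proof -
      obtain T where "openin X T" "U \<inter> L i = T \<inter> L i"
        using *[rule_format, of i] unfolding openin_subtopology by blast
      then have "openin X (T \<inter> G i)" "U \<inter> G i = T \<inter> G i"
        using GL(1,4)[of i] by blast+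
      then show ?thesis
        by simp
    qed
    then have "openin X (\<Union>i. U \<inter> G i)"
      by blast
    moreover have "(\<Union>i. U \<inter> G i) = U"
    proof -
      have "topspace X \<subseteq> (\<Union>i. G i)"
        unfolding K(2)[symmetric] by (intro UN_mono[OF subset_refl] GL(3))
      then show ?thesis
        using U by auto
    qed
    ultimately show "openin X U"
      by simp
  qed
  ultimately show ?thesis
    unfolding k_omega_space_def using GL(2) by (intro exI[of _ L]) simp
qed


section \<open>Quasi-uniformizability\<close>

definition monotone_pairs :: "'a topology \<Rightarrow> 'a rel \<Rightarrow> ('a set \<times> 'a set) set" where
  "monotone_pairs X R = {(A, U). closedin X A \<and> decreasing_set R A \<and>
     openin X U \<and> decreasing_set R U \<and> A \<subseteq> U}"

definition separation_entourage :: "'a set \<Rightarrow> ('a set \<times> 'a set) set \<Rightarrow> 'a rel" where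
  "separation_entourage E F = {(p, q). p \<in> E \<and> q \<in> E \<and> (\<forall>(A, U)\<in>F. q \<in> A \<longrightarrow> p \<in> U)}"

definition separation_quasi_uniformity :: "'a topology \<Rightarrow> 'a rel \<Rightarrow> 'a rel set" where
  "separation_quasi_uniformity X R =
     {V. V \<subseteq> topspace X \<times> topspace X \<and>
         (\<exists>F. finite F \<and> F \<subseteq> monotone_pairs X R \<and> separation_entourage (topspace X) F \<subseteq> V)}"

lemma mem_separation_entourage:
  "(p, q) \<in> separation_entourage E F \<longleftrightarrow>
     p \<in> E \<and> q \<in> E \<and> (\<forall>A U. (A, U) \<in> F \<longrightarrow> q \<in> A \<longrightarrow> p \<in> U)"
  by (auto simp: separation_entourage_def)

lemma separation_entourage_subset: "separation_entourage E F \<subseteq> E \<times> E"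
  by (auto simp: separation_entourage_def)

lemma separation_quasi_uniformityE:
  assumes "V \<in> separation_quasi_uniformity X R"
  obtains F where "finite F" "F \<subseteq> monotone_pairs X R" "separation_entourage (topspace X) F \<subseteq> V"
  using assms unfolding separation_quasi_uniformity_def by blast

lemma separation_quasi_uniformityI:
  assumes "finite F" "F \<subseteq> monotone_pairs X R" "separation_entourage (topspace X) F \<subseteq> V"
    "V \<subseteq> topspace X \<times> topspace X"
  shows "V \<in> separation_quasi_uniformity X R"
  using assms unfolding separation_quasi_uniformity_def by blast

lemma separation_entourage_in_quasi_uniformity:
  assumes "finite F" "F \<subseteq> monotone_pairs X R"
  shows "separation_entourage (topspace X) F \<in> separation_quasi_uniformity X R"
  by (rule separation_quasi_uniformityI[OF assms subset_refl separation_entourage_subset])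

lemma monotone_pair_interpolation:
  assumes R: "T2_preordered X R" and N: "normally_preordered X R"
    and AU: "(A, U) \<in> monotone_pairs X R"
  obtains M C where "(A, M) \<in> monotone_pairs X R" "M \<subseteq> C" "(C, U) \<in> monotone_pairs X R"
proof -
  have AU: "closedin X A" "decreasing_set R A" "openin X U" "decreasing_set R U" "A \<subseteq> U"
    using AU unfolding monotone_pairs_def by auto
  have "closedin X (topspace X - U)" "increasing_set R (topspace X - U)"
    using AU(3,4) R by (auto intro: increasing_Diff_decreasing)
  moreover have "A \<inter> (topspace X - U) = {}"
    using AU(5) by blast
  ultimately obtain M V where MV: "openin X M" "decreasing_set R M" "openin X V"
    "increasing_set R V" "A \<subseteq> M" "topspace X - U \<subseteq> V" "M \<inter> V = {}"
    by (rule normally_preorderedE[OF N AU(1,2)])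
  show thesis
  proof (rule that[of M "topspace X - V"])
    show "(A, M) \<in> monotone_pairs X R"
      using MV AU unfolding monotone_pairs_def by auto
    show "M \<subseteq> topspace X - V"
      using MV(7) openin_subset[OF MV(1)] by blast
    have "decreasing_set R (topspace X - V)"
      by (rule decreasing_Diff_increasing[OF R MV(4)])
    then show "(topspace X - V, U) \<in> monotone_pairs X R"
      using MV(3,6) AU(3,4) unfolding monotone_pairs_def by auto
  qed
qed

text \<open>Composition is handled on the subbase: if \<open>A \<subseteq> M \<subseteq> C \<subseteq> U\<close>, then the entourage of the
  two pairs \<open>(A, M)\<close> and \<open>(C, U)\<close> composes with itself into the entourage of \<open>(A, U)\<close>.\<close>

lemma quasi_uniformity_separation:
  assumes R: "T2_preordered X R" and N: "normally_preordered X R"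
  shows "quasi_uniformity (topspace X) (separation_quasi_uniformity X R)"
proof -
  let ?E = "topspace X" and ?Q = "separation_quasi_uniformity X R"
  let ?I = "separation_entourage (topspace X)"
  have sub: "V \<subseteq> ?E \<times> ?E" if "V \<in> ?Q" for V
    using that unfolding separation_quasi_uniformity_def by blast
  have ne: "?Q \<noteq> {}"
    using separation_entourage_in_quasi_uniformity[of "{}" X R] by auto
  have int: "V \<inter> W \<in> ?Q" if VW: "V \<in> ?Q" "W \<in> ?Q" for V W
  proof -
    obtain F where F: "finite F" "F \<subseteq> monotone_pairs X R" "?I F \<subseteq> V"
      using separation_quasi_uniformityE[OF VW(1)] .
    obtain G where G: "finite G" "G \<subseteq> monotone_pairs X R" "?I G \<subseteq> W"
      using separation_quasi_uniformityE[OF VW(2)] .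
    have "?I (F \<union> G) \<subseteq> ?I F \<inter> ?I G"
      unfolding separation_entourage_def by auto
    then show ?thesis
      using F G sub[OF VW(1)] by (intro separation_quasi_uniformityI[of "F \<union> G"]) auto
  qed
  have up: "W \<in> ?Q" if V: "V \<in> ?Q" and W: "V \<subseteq> W" "W \<subseteq> ?E \<times> ?E" for V W
  proof -
    obtain F where F: "finite F" "F \<subseteq> monotone_pairs X R" "?I F \<subseteq> V"
      using separation_quasi_uniformityE[OF V] .
    then show ?thesis
      using W by (intro separation_quasi_uniformityI[of F]) auto
  qed
  have diag: "Id_on ?E \<subseteq> V" if V: "V \<in> ?Q" for V
  proof -
    obtain F where F: "finite F" "F \<subseteq> monotone_pairs X R" "?I F \<subseteq> V"
      using separation_quasi_uniformityE[OF V] .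
    have "(x, x) \<in> ?I F" if "x \<in> ?E" for x
      using F(2) that unfolding mem_separation_entourage monotone_pairs_def by auto
    then show ?thesis
      using F(3) by auto
  qed
  have comp: "\<exists>W\<in>?Q. W O W \<subseteq> V" if V: "V \<in> ?Q" for V
  proof -
    obtain F where F: "finite F" "F \<subseteq> monotone_pairs X R" "?I F \<subseteq> V"
      using separation_quasi_uniformityE[OF V] .
    have "\<exists>M C. (fst p, M) \<in> monotone_pairs X R \<and> M \<subseteq> C \<and> (C, snd p) \<in> monotone_pairs X R"
      if "p \<in> F" for p
    proof -
      have "(fst p, snd p) \<in> monotone_pairs X R"
        using that F(2) by auto
      then show ?thesis
        by (rule monotone_pair_interpolation[OF R N]) blast
    qed
    then obtain M C where MC: "\<And>p. p \<in> F \<Longrightarrow> (fst p, M p) \<in> monotone_pairs X R"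
      "\<And>p. p \<in> F \<Longrightarrow> M p \<subseteq> C p" "\<And>p. p \<in> F \<Longrightarrow> (C p, snd p) \<in> monotone_pairs X R"
      by metis
    define G where "G = (\<lambda>p. (fst p, M p)) ` F \<union> (\<lambda>p. (C p, snd p)) ` F"
    have G: "finite G" "G \<subseteq> monotone_pairs X R"
      using F(1) MC(1,3) unfolding G_def by auto
    have "?I G O ?I G \<subseteq> ?I F"
    proof
      fix w assume "w \<in> ?I G O ?I G"
      then obtain x y z where w: "w = (x, z)" and xyz: "(x, y) \<in> ?I G" "(y, z) \<in> ?I G"
        by blast
      have "x \<in> U" if AU: "(A, U) \<in> F" and z: "z \<in> A" for A U
      proof -
        have "(A, M (A, U)) \<in> G" "(C (A, U), U) \<in> G"
          unfolding G_def using AU by force+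
        then show ?thesis
          using xyz z MC(2)[OF AU] unfolding mem_separation_entourage by blast
      qed
      then show "w \<in> ?I F"
        unfolding w mem_separation_entourage using xyz by (simp add: mem_separation_entourage)
    qed
    then have "?I G O ?I G \<subseteq> V"
      using F(3) by (rule subset_trans)
    then show ?thesis
      using separation_entourage_in_quasi_uniformity[OF G] by (rule bexI)
  qed
  have "?Q \<subseteq> Pow (?E \<times> ?E)"
    using sub by blast
  then show ?thesis
    unfolding quasi_uniformity_def
    by (intro conjI ballI allI impI ne int diag comp) (assumption | elim conjE, rule up)+
qed

text \<open>If \<open>x\<close> is not below \<open>y\<close>, then \<open>d(y)\<close> misses \<open>i(x)\<close>, and the entourage of the pair of \<open>d(y)\<close> and
  the complement of \<open>i(x)\<close> does not contain \<open>(x, y)\<close>.\<close>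

lemma Inter_separation_quasi_uniformity:
  assumes R: "T2_preordered X R"
  shows "\<Inter>(separation_quasi_uniformity X R) = R"
proof
  let ?E = "topspace X"
  note P = T2_preorderedD[OF R]
  show "R \<subseteq> \<Inter>(separation_quasi_uniformity X R)"
  proof (intro Inter_greatest)
    fix V assume "V \<in> separation_quasi_uniformity X R"
    then obtain F where F: "F \<subseteq> monotone_pairs X R" "separation_entourage ?E F \<subseteq> V"
      by (rule separation_quasi_uniformityE)
    have "x \<in> U" if "(x, y) \<in> R" "(A, U) \<in> F" "y \<in> A" for x y A U
    proof -
      have "decreasing_set R A" "A \<subseteq> U"
        using that(2) F(1) unfolding monotone_pairs_def by auto
      then show ?thesis
        using that(1,3) unfolding decreasing_set_def dec_hull_def by blast
    qed
    then have "(x, y) \<in> separation_entourage ?E F" if "(x, y) \<in> R" for x y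
      using P(1) that unfolding mem_separation_entourage by auto
    then show "R \<subseteq> V"
      using F(2) by auto
  qed
  show "\<Inter>(separation_quasi_uniformity X R) \<subseteq> R"
  proof
    fix w assume w: "w \<in> \<Inter>(separation_quasi_uniformity X R)"
    obtain x y where xy: "w = (x, y)"
      by (cases w)
    have ent: "(x, y) \<in> separation_entourage ?E F" if "finite F" "F \<subseteq> monotone_pairs X R" for F
      using InterD[OF w separation_entourage_in_quasi_uniformity[OF that]] unfolding xy .
    have E: "x \<in> ?E" "y \<in> ?E"
      using ent[of "{}"] by (simp_all add: mem_separation_entourage)
    show "w \<in> R"
      unfolding xy
    proof (rule ccontr)
      assume n: "(x, y) \<notin> R"
      have "dec_hull R {y} \<subseteq> ?E - inc_hull R {x}"
        using n P(1,3) unfolding dec_hull_def inc_hull_def by blast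
      then have "(dec_hull R {y}, ?E - inc_hull R {x}) \<in> monotone_pairs X R"
        unfolding monotone_pairs_def using E
        by (auto intro!: closedin_dec_hull decreasing_dec_hull closedin_inc_hull
            increasing_inc_hull decreasing_Diff_increasing R)
      then have "(x, y) \<in> separation_entourage ?E {(dec_hull R {y}, ?E - inc_hull R {x})}"
        by (intro ent) auto
      then show False
        using P(2) E unfolding mem_separation_entourage dec_hull_def inc_hull_def by auto
    qed
  qed
qed

text \<open>Because \<open>A \<subseteq> U\<close>, the section at \<open>x\<close> of a subbasic entourage is the whole space or the
  complement of the closed set \<open>A\<close>, and that of its converse is the whole space or the open set
  \<open>U\<close>. Hence the topology of the quasi-uniformity is coarser than the given one.\<close>

lemma separation_quasi_uniformity_sections:
  assumes V: "V \<in> separation_quasi_uniformity X R" and x: "x \<in> topspace X"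
  obtains S T where "openin X S" "x \<in> S" "S \<subseteq> V `` {x}" "openin X T" "x \<in> T" "T \<subseteq> V\<inverse> `` {x}"
proof -
  let ?E = "topspace X"
  obtain F where F: "finite F" "F \<subseteq> monotone_pairs X R" "separation_entourage ?E F \<subseteq> V"
    using separation_quasi_uniformityE[OF V] .
  have pair: "closedin X A" "openin X U" "A \<subseteq> U" if "(A, U) \<in> F" for A U
    using that F(2) unfolding monotone_pairs_def by auto
  define S where "S = ?E \<inter> \<Inter>((\<lambda>(A, U). if x \<in> U then ?E else ?E - A) ` F)"
  define T where "T = ?E \<inter> \<Inter>((\<lambda>(A, U). if x \<in> A then U else ?E) ` F)"
  show thesis
  proof (rule that[of S T])
    show "openin X S" "openin X T"
      unfolding S_def T_def using F(1) by (auto intro!: openin_Int_Inter openin_diff intro: pair)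
    show "x \<in> S" "x \<in> T"
      unfolding S_def T_def using x by (auto dest: subsetD[OF pair(3)])
    have "(x, y) \<in> separation_entourage ?E F" if "y \<in> S" for y
      using that x unfolding S_def mem_separation_entourage by (force split: if_splits)
    then show "S \<subseteq> V `` {x}"
      using F(3) by auto
    have "(y, x) \<in> separation_entourage ?E F" if "y \<in> T" for y
      using that x unfolding T_def mem_separation_entourage by (force split: if_splits)
    then show "T \<subseteq> V\<inverse> `` {x}"
      using F(3) by auto
  qed
qed

text \<open>At a point \<open>x\<close> of \<open>U \<inter> V\<close>, with \<open>U\<close> open decreasing and \<open>V\<close> open increasing, the set \<open>V\<close>
  is the section at \<open>x\<close> of the entourage of the pair \<open>(- V, - inc_hull R {x})\<close>, and \<open>U\<close> that of
  the converse entourage of \<open>(dec_hull R {x}, U)\<close>.\<close>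

lemma quasi_uniformizable_of_normal_convex:
  assumes R: "T2_preordered X R" and N: "normally_preordered X R" and C: "convex_space X R"
  shows "quasi_uniformizable X R"
proof -
  let ?E = "topspace X" and ?Q = "separation_quasi_uniformity X R"
  note P = T2_preorderedD[OF R]
  have Q: "quasi_uniformity ?E ?Q"
    by (rule quasi_uniformity_separation[OF R N])
  have "openin X W \<longleftrightarrow> W \<subseteq> ?E \<and> (\<forall>x\<in>W. \<exists>D\<in>star_uniformity ?Q. D `` {x} \<subseteq> W)" (is "_ \<longleftrightarrow> ?rhs") for W
  proof
    assume W: "openin X W"
    show ?rhs
    proof (intro conjI ballI)
      show "W \<subseteq> ?E"
        using W by (rule openin_subset)
      fix x assume xW: "x \<in> W"
      then have x: "x \<in> ?E"
        using openin_subset[OF W] by blast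
      then obtain U V where UV: "openin X U" "decreasing_set R U" "openin X V" "increasing_set R V"
        "x \<in> U" "x \<in> V" "U \<inter> V \<subseteq> W"
        using C W xW unfolding convex_space_def convex_at_def by (metis IntE)
      have "inc_hull R {x} \<subseteq> V" "dec_hull R {x} \<subseteq> U"
        using UV(2,4-6) unfolding increasing_set_def decreasing_set_def inc_hull_def dec_hull_def
        by blast+
      then have "(?E - V, ?E - inc_hull R {x}) \<in> monotone_pairs X R"
          "(dec_hull R {x}, U) \<in> monotone_pairs X R"
        unfolding monotone_pairs_def using x UV
        by (auto intro!: closedin_dec_hull decreasing_dec_hull closedin_inc_hull
            increasing_inc_hull decreasing_Diff_increasing R)
      then have "separation_entourage ?E {(?E - V, ?E - inc_hull R {x})} \<in> ?Q" (is "?D1 \<in> _")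
          "separation_entourage ?E {(dec_hull R {x}, U)} \<in> ?Q" (is "?D2 \<in> _")
        by (auto intro!: separation_entourage_in_quasi_uniformity)
      then have D: "?D1 \<inter> ?D2\<inverse> \<in> star_uniformity ?Q"
        unfolding star_uniformity_def by blast
      have "(?D1 \<inter> ?D2\<inverse>) `` {x} \<subseteq> U \<inter> V"
        using P(2)[OF x] by (auto simp: mem_separation_entourage dec_hull_def inc_hull_def)
      then have "(?D1 \<inter> ?D2\<inverse>) `` {x} \<subseteq> W"
        using UV(7) by (rule subset_trans)
      then show "\<exists>D\<in>star_uniformity ?Q. D `` {x} \<subseteq> W"
        using D by (rule bexI)
    qed
  next
    assume W: ?rhs
    show "openin X W"
    proof (subst openin_subopen, intro ballI)
      fix x assume xW: "x \<in> W"
      then obtain V V' where V: "V \<in> ?Q" "V' \<in> ?Q" "(V \<inter> V'\<inverse>) `` {x} \<subseteq> W"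
        using W unfolding star_uniformity_def by blast
      have x: "x \<in> ?E"
        using W xW by blast
      obtain S where S: "openin X S" "x \<in> S" "S \<subseteq> V `` {x}"
        using separation_quasi_uniformity_sections[OF V(1) x] by metis
      obtain T where T: "openin X T" "x \<in> T" "T \<subseteq> V'\<inverse> `` {x}"
        using separation_quasi_uniformity_sections[OF V(2) x] by metis
      have "S \<inter> T \<subseteq> W"
        using S(3) T(3) V(3) by blast
      then show "\<exists>T. openin X T \<and> x \<in> T \<and> T \<subseteq> W"
        using openin_Int[OF S(1) T(1)] S(2) T(2) by blast
    qed
  qed
  then have "X = uniform_topology ?E (star_uniformity ?Q)"
    unfolding topology_eq openin_uniform_topology[OF is_uniformity_star_uniformity[OF Q]] by blast
  then show ?thesis
    unfolding quasi_uniformizable_def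
    using Q Inter_separation_quasi_uniformity[OF R, symmetric] by blast
qed


section \<open>The convexity theorem\<close>

theorem theorem3p3:
  fixes X :: "'a topology" and R :: "'a rel"
  shows
    "(T2_preordered X R \<and> k_preserving X R \<and> k_omega_space X \<longrightarrow>
        (\<forall>x \<in> topspace X. class_indistinguishable_at X R x \<and> locally_compact_at X x
             \<longrightarrow> convex_at X R x) \<and>
        (\<forall>x \<in> topspace X. locally_compact_at X x \<and> antisymmetric_at R x
             \<longrightarrow> convex_at X R x)) \<and>
     (T2_ordered X R \<and> k_preserving X R \<and> locally_compact_space X \<and> sigma_compact_space X \<longrightarrow>
        convex_space X R \<and> quasi_uniformizable X R)"
proof (intro conjI impI)
  assume "T2_preordered X R \<and> k_preserving X R \<and> k_omega_space X"
  then have R: "T2_preordered X R" "k_preserving X R" "k_omega_space X"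
    by simp_all
  note convex = convex_at_of_class_indistinguishable[OF R]
  show "\<forall>x \<in> topspace X. class_indistinguishable_at X R x \<and> locally_compact_at X x
      \<longrightarrow> convex_at X R x"
    using convex by simp
  show "\<forall>x \<in> topspace X. locally_compact_at X x \<and> antisymmetric_at R x \<longrightarrow> convex_at X R x"
    using convex[OF _ antisymmetric_imp_class_indistinguishable] by simp
next
  assume *: "T2_ordered X R \<and> k_preserving X R \<and> locally_compact_space X \<and> sigma_compact_space X"
  then have R: "T2_preordered X R" and "antisym R" and k: "k_preserving X R"
    unfolding T2_ordered_def by simp_all
  have X: "k_omega_space X"
    using * by (intro locally_compact_sigma_compact_imp_k_omega) simp_all
  have "antisymmetric_at R x" if "x \<in> topspace X" for x
    using T2_preorderedD(2)[OF R that] antisymD[OF \<open>antisym R\<close>]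
    unfolding antisymmetric_at_def order_class_def dec_hull_def inc_hull_def by auto
  then show convex: "convex_space X R"
    unfolding convex_space_def
    using convex_at_of_class_indistinguishable[OF R k X _ antisymmetric_imp_class_indistinguishable]
    by simp
  show "quasi_uniformizable X R"
    by (rule quasi_uniformizable_of_normal_convex[OF R k_omega_imp_normally_preordered[OF R X] convex])
qed

end
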